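(* The cut rule is eliminable in the calculus $\mathrm{L}^{\circlearrowleft}$ (the Lambek calculus with cyclic shift): every sequent derivable in $\mathrm{L}^{\circlearrowleft}$ has a derivation in $\mathrm{L}^{\circlearrowleft}$ that does not use the rule $(\mathrm{cut})$.
   Context: Types of $\mathrm{L}^{\circlearrowleft}$ are built from primitive types (elements of a fixed set $Pr$) using the binary connectives $\backslash$, $/$, $\cdot$ and a unary connective $A\mapsto A^{\circlearrowleft}$. A sequent is an expression $A_1,\dots,A_n\to B$ where $n\ge 1$ and $A_i,B$ are types. Capital Latin letters denote types, $\Gamma,\Delta$ denote finite (possibly empty) sequences of types, and $\Pi,\Psi$ denote nonempty finite sequences of types. The axioms and rules of $\mathrm{L}^{\circlearrowleft}$ are: - $(\mathrm{Ax})$: $A\to A$. - $(\backslash\to)$: from $\Gamma,B,\Delta\to C$ and $\Pi\to A$ infer $\Gamma,\Pi,A\backslash B,\Delta\to C$. - $(\to\backslash)$: from $A,\Pi\to B$ infer $\Pi\to A\backslash B$. - $(/\to)$: from $\Gamma,B,\Delta\to C$ and $\Pi\to A$ infer $\Gamma,B/A,\Pi,\Delta\to C$. - $(\to/)$: from $\Pi,A\to B$ infer $\Pi\to B/A$. - $(\cdot\to)$: from $\Gamma,A,B,\Delta\to C$ infer $\Gamma,A\cdot B,\Delta\to C$. - $(\to\cdot)$: from $\Pi\to A$ and $\Psi\to B$ infer $\Pi,\Psi\to A\cdot B$. - $(\mathrm{cut})$: from $\Pi\to A$ and $\Gamma,A,\Delta\to B$ infer $\Gamma,\Pi,\Delta\to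 B$. - $(\to^{\circlearrowleft})$: from $\Pi\to A$ infer $\Pi\to A^{\circlearrowleft}$. - $(^{\circlearrowleft}\to)$: from $B\to A^{\circlearrowleft}$ infer $B^{\circlearrowleft}\to A^{\circlearrowleft}$. - $(\circlearrowleft)$: from $\Pi,\Psi\to A^{\circlearrowleft}$ infer $\Psi,\Pi\to A^{\circlearrowleft}$. *)

theory Defs
  imports Main
begin

datatype 'p tp =
    Prim 'p
  | Under "'p tp" "'p tp"  (infixr \<open>\<^bold>\<setminus>\<close> 70)
  | Over "'p tp" "'p tp"   (infixl \<open>\<^bold>'/\<close> 70)
  | Prod "'p tp" "'p tp"   (infixl \<open>\<^bold>\<cdot>\<close> 70)
  | Cyc "'p tp"

text \<open>
  The antecedent of a sequent is meant to be nonempty. The datatype does not enforce this, but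
  the nonemptiness conditions in the rules below do: see \<open>inference_antecedent_nonempty\<close>.
\<close>

datatype 'p sequent = Sequent (antecedent: "'p tp list") (succedent: "'p tp")  (infix \<open>\<turnstile>\<close> 50)

datatype rule =
    Ax | UnderL | UnderR | OverL | OverR | ProdL | ProdR | Cut | CycR | CycL | CycShift

text \<open>
  \<open>inference r Ps S\<close>: the sequent \<open>S\<close> follows from the list of premises \<open>Ps\<close> by one instance of
  the rule \<open>r\<close>. The sequences written \<open>\<Pi>\<close> and \<open>\<Psi>\<close> are nonempty, while \<open>\<Gamma>\<close> and \<open>\<Delta>\<close> may be empty.
\<close>

inductive inference :: "rule \<Rightarrow> 'p sequent list \<Rightarrow> 'p sequent \<Rightarrow> bool" where
  Ax: "inference Ax [] ([A] \<turnstile> A)"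
| UnderL: "\<Pi> \<noteq> [] \<Longrightarrow>
    inference UnderL [\<Gamma> @ [B] @ \<Delta> \<turnstile> C, \<Pi> \<turnstile> A] (\<Gamma> @ \<Pi> @ [A \<^bold>\<setminus> B] @ \<Delta> \<turnstile> C)"
| UnderR: "\<Pi> \<noteq> [] \<Longrightarrow> inference UnderR [[A] @ \<Pi> \<turnstile> B] (\<Pi> \<turnstile> A \<^bold>\<setminus> B)"
| OverL: "\<Pi> \<noteq> [] \<Longrightarrow>
    inference OverL [\<Gamma> @ [B] @ \<Delta> \<turnstile> C, \<Pi> \<turnstile> A] (\<Gamma> @ [B \<^bold>/ A] @ \<Pi> @ \<Delta> \<turnstile> C)"
| OverR: "\<Pi> \<noteq> [] \<Longrightarrow> inference OverR [\<Pi> @ [A] \<turnstile> B] (\<Pi> \<turnstile> B \<^bold>/ A)"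
| ProdL: "inference ProdL [\<Gamma> @ [A, B] @ \<Delta> \<turnstile> C] (\<Gamma> @ [A \<^bold>\<cdot> B] @ \<Delta> \<turnstile> C)"
| ProdR: "\<Pi> \<noteq> [] \<Longrightarrow> \<Psi> \<noteq> [] \<Longrightarrow>
    inference ProdR [\<Pi> \<turnstile> A, \<Psi> \<turnstile> B] (\<Pi> @ \<Psi> \<turnstile> A \<^bold>\<cdot> B)"
| Cut: "\<Pi> \<noteq> [] \<Longrightarrow>
    inference Cut [\<Pi> \<turnstile> A, \<Gamma> @ [A] @ \<Delta> \<turnstile> B] (\<Gamma> @ \<Pi> @ \<Delta> \<turnstile> B)"
| CycR: "\<Pi> \<noteq> [] \<Longrightarrow> inference CycR [\<Pi> \<turnstile> A] (\<Pi> \<turnstile> Cyc A)"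
| CycL: "inference CycL [[B] \<turnstile> Cyc A] ([Cyc B] \<turnstile> Cyc A)"
| CycShift: "\<Pi> \<noteq> [] \<Longrightarrow> \<Psi> \<noteq> [] \<Longrightarrow>
    inference CycShift [\<Pi> @ \<Psi> \<turnstile> Cyc A] (\<Psi> @ \<Pi> \<turnstile> Cyc A)"

lemma inference_antecedent_nonempty: "inference r Ps S \<Longrightarrow> antecedent S \<noteq> []"
  by (cases rule: inference.cases) auto

datatype 'p derivation =
  Infer rule (conclusion: "'p sequent") "'p derivation list"

fun correct :: "'p derivation \<Rightarrow> bool" where
  "correct (Infer r S ds) \<longleftrightarrow> inference r (map conclusion ds) S \<and> (\<forall>d \<in> set ds. correct d)"

fun rules_used :: "'p derivation \<Rightarrow> rule set" where
  "rules_used (Infer r S ds) = insert r (\<Union>d \<in> set ds. rules_used d)"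

definition derivation_of :: "'p derivation \<Rightarrow> 'p sequent \<Rightarrow> bool" where
  "derivation_of d S \<longleftrightarrow> correct d \<and> conclusion d = S"

definition derivable :: "'p sequent \<Rightarrow> bool" where
  "derivable S \<longleftrightarrow> (\<exists>d. derivation_of d S)"

end

theory Submission
  imports Defs
begin

text \<open>
  Cut admissibility is proved by induction on the cut formula and, for a fixed cut formula, by
  induction on the right premise. The order matters: a cyclic shift in the left premise cannot be
  permuted below a cut whose context is nonempty. Once the cut formula is principal on the right,
  the left premise is analysed: implications are inverted, while for a product and for
  \<open>Cyc B\<close> the left premise is taken apart by a second induction. In the latter case the right
  premise is \<open>Cyc B \<rightarrow> Cyc A\<close>, so the context is empty and shifts do permute.
\<close>

text \<open>A predicate on sequents, rather than on trees, gives rule induction directly.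
  Nonemptiness conditions remain only where the premises do not already imply them.\<close>

inductive cut_free :: "'p tp list \<Rightarrow> 'p tp \<Rightarrow> bool" where
  Ax: "cut_free [A] A"
| UnderL: "cut_free (\<Gamma> @ [B] @ \<Delta>) C \<Longrightarrow> cut_free \<Pi> A \<Longrightarrow>
    cut_free (\<Gamma> @ \<Pi> @ [A \<^bold>\<setminus> B] @ \<Delta>) C"
| UnderR: "\<Pi> \<noteq> [] \<Longrightarrow> cut_free ([A] @ \<Pi>) B \<Longrightarrow> cut_free \<Pi> (A \<^bold>\<setminus> B)"
| OverL: "cut_free (\<Gamma> @ [B] @ \<Delta>) C \<Longrightarrow> cut_free \<Pi> A \<Longrightarrow>
    cut_free (\<Gamma> @ [B \<^bold>/ A] @ \<Pi> @ \<Delta>) C"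
| OverR: "\<Pi> \<noteq> [] \<Longrightarrow> cut_free (\<Pi> @ [A]) B \<Longrightarrow> cut_free \<Pi> (B \<^bold>/ A)"
| ProdL: "cut_free (\<Gamma> @ [A, B] @ \<Delta>) C \<Longrightarrow> cut_free (\<Gamma> @ [A \<^bold>\<cdot> B] @ \<Delta>) C"
| ProdR: "cut_free \<Pi> A \<Longrightarrow> cut_free \<Psi> B \<Longrightarrow> cut_free (\<Pi> @ \<Psi>) (A \<^bold>\<cdot> B)"
| CycR: "cut_free \<Pi> A \<Longrightarrow> cut_free \<Pi> (Cyc A)"
| CycL: "cut_free [B] (Cyc A) \<Longrightarrow> cut_free [Cyc B] (Cyc A)"
| CycShift: "\<Pi> \<noteq> [] \<Longrightarrow> \<Psi> \<noteq> [] \<Longrightarrow> cut_free (\<Pi> @ \<Psi>) (Cyc A) \<Longrightarrow>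
    cut_free (\<Psi> @ \<Pi>) (Cyc A)"

lemma cut_free_nonempty: "cut_free \<Pi> A \<Longrightarrow> \<Pi> \<noteq> []"
  by (induction rule: cut_free.induct) auto

section \<open>From the predicate \<open>cut_free\<close> back to derivation trees\<close>

lemma derivation_step:
  assumes "inference r Ps S" "r \<noteq> Cut"
    and "\<forall>P \<in> set Ps. \<exists>d. derivation_of d P \<and> Cut \<notin> rules_used d"
  shows "\<exists>d. derivation_of d S \<and> Cut \<notin> rules_used d"
proof -
  obtain f where f: "\<forall>P \<in> set Ps. derivation_of (f P) P \<and> Cut \<notin> rules_used (f P)"
    using assms(3) by metis
  have "map conclusion (map f Ps) = Ps"
    using f by (auto simp: derivation_of_def intro: map_idI)
  then have "derivation_of (Infer r S (map f Ps)) S"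
    using assms(1) f by (auto simp: derivation_of_def simp del: map_map)
  moreover have "Cut \<notin> rules_used (Infer r S (map f Ps))"
    using assms(2) f by auto
  ultimately show ?thesis by blast
qed

lemma cut_free_imp_derivation:
  "cut_free \<Gamma> A \<Longrightarrow> \<exists>d. derivation_of d (\<Gamma> \<turnstile> A) \<and> Cut \<notin> rules_used d"
proof (induction rule: cut_free.induct)
  case Ax
  show ?case by (rule derivation_step[OF inference.Ax]) simp_all
next
  case UnderL
  then show ?case
    by (intro derivation_step[OF inference.UnderL]) (simp_all add: cut_free_nonempty)
next
  case UnderR
  then show ?case
    by (intro derivation_step[OF inference.UnderR]) (simp_all add: cut_free_nonempty)
next
  case OverL
  then show ?case
    by (intro derivation_step[OF inference.OverL]) (simp_all add: cut_free_nonempty)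
next
  case OverR
  then show ?case
    by (intro derivation_step[OF inference.OverR]) (simp_all add: cut_free_nonempty)
next
  case ProdL
  then show ?case
    by (intro derivation_step[OF inference.ProdL]) (simp_all add: cut_free_nonempty)
next
  case ProdR
  then show ?case
    by (intro derivation_step[OF inference.ProdR]) (simp_all add: cut_free_nonempty)
next
  case CycR
  then show ?case
    by (intro derivation_step[OF inference.CycR]) (simp_all add: cut_free_nonempty)
next
  case CycL
  then show ?case
    by (intro derivation_step[OF inference.CycL]) (simp_all add: cut_free_nonempty)
next
  case CycShift
  then show ?case
    by (intro derivation_step[OF inference.CycShift]) (simp_all add: cut_free_nonempty)
qed

section \<open>Analysis of the left premise of a principal cut\<close>

lemma Under_inversion: "cut_free \<Pi> (A \<^bold>\<setminus> B) \<Longrightarrow> cut_free (A # \<Pi>) B"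
\<comment> \<open>An implication as succedent excludes \<open>CycL\<close> and
  \<open>CycShift\<close>, so only the axiom, \<open>UnderR\<close> and the left rules remain. The
  left rules absorb the new \<open>A\<close> into their left context.\<close>
proof (induction \<Pi> "A \<^bold>\<setminus> B" rule: cut_free.induct)
  case Ax
  show ?case using UnderL[of "[]" B "[]" B "[A]" A] by (simp add: cut_free.Ax)
next
  case (UnderL \<Gamma> X \<Delta> \<Pi> Y)
  then show ?case using cut_free.UnderL[of "A # \<Gamma>" X \<Delta> B \<Pi> Y] by simp
next
  case (OverL \<Gamma> X \<Delta> \<Pi> Y)
  then show ?case using cut_free.OverL[of "A # \<Gamma>" X \<Delta> B \<Pi> Y] by simp
next
  case (ProdL \<Gamma> X Y \<Delta>)
  then show ?case using cut_free.ProdL[of "A # \<Gamma>" X Y \<Delta> B] by simp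
qed simp

lemma Over_inversion: "cut_free \<Pi> (B \<^bold>/ A) \<Longrightarrow> cut_free (\<Pi> @ [A]) B"
proof (induction \<Pi> "B \<^bold>/ A" rule: cut_free.induct)
  case Ax
  show ?case using OverL[of "[]" B "[]" B "[A]" A] by (simp add: cut_free.Ax)
next
  case (UnderL \<Gamma> X \<Delta> \<Pi> Y)
  then show ?case using cut_free.UnderL[of \<Gamma> X "\<Delta> @ [A]" B \<Pi> Y] by simp
next
  case (OverL \<Gamma> X \<Delta> \<Pi> Y)
  then show ?case using cut_free.OverL[of \<Gamma> X "\<Delta> @ [A]" B \<Pi> Y] by simp
next
  case (ProdL \<Gamma> X Y \<Delta>)
  then show ?case using cut_free.ProdL[of \<Gamma> X Y "\<Delta> @ [A]" B] by simp
qed simp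

text \<open>Since the succedent of the left premise is a product, it involves no shift on the way
  down from \<open>ProdR\<close>. The left rules therefore permute below the cut by enlarging their
  contexts with \<Gamma> and \<Delta>. The last assumption stands for the two cuts on the
  factors.\<close>

lemma cut_Prod:
  assumes "cut_free \<Pi> (A \<^bold>\<cdot> B)" and "cut_free (\<Gamma> @ [A, B] @ \<Delta>) C"
    and "\<And>\<Pi> \<Psi>. cut_free \<Pi> A \<Longrightarrow> cut_free \<Psi> B \<Longrightarrow> cut_free (\<Gamma> @ \<Pi> @ \<Psi> @ \<Delta>) C"
  shows "cut_free (\<Gamma> @ \<Pi> @ \<Delta>) C"
  using assms(1)
proof (induction \<Pi> "A \<^bold>\<cdot> B" rule: cut_free.induct)
  case Ax
  show ?case using cut_free.ProdL[OF assms(2)] .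
next
  case (UnderL \<Gamma>' X \<Delta>' \<Pi> Y)
  then show ?case using cut_free.UnderL[of "\<Gamma> @ \<Gamma>'" X "\<Delta>' @ \<Delta>" C \<Pi> Y] by simp
next
  case (OverL \<Gamma>' X \<Delta>' \<Pi> Y)
  then show ?case using cut_free.OverL[of "\<Gamma> @ \<Gamma>'" X "\<Delta>' @ \<Delta>" C \<Pi> Y] by simp
next
  case (ProdL \<Gamma>' X Y \<Delta>')
  then show ?case using cut_free.ProdL[of "\<Gamma> @ \<Gamma>'" X Y "\<Delta>' @ \<Delta>" C] by simp
next
  case (ProdR \<Pi> \<Psi>)
  then show ?case using assms(3) by simp
qed

lemma cut_Cyc:
  assumes "cut_free \<Pi> (Cyc B)" and "cut_free [B] (Cyc A)"
    and "\<And>\<Pi>. cut_free \<Pi> B \<Longrightarrow> cut_free \<Pi> (Cyc A)"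
  shows "cut_free \<Pi> (Cyc A)"
  using assms(1)
proof (induction \<Pi> "Cyc B" rule: cut_free.induct)
  case Ax
  show ?case using cut_free.CycL[OF assms(2)] .
next
  case (CycR \<Pi>)
  then show ?case using assms(3) by simp
next
  case (CycShift \<Pi> \<Psi>)
  then show ?case by (blast intro: cut_free.CycShift[of \<Pi> \<Psi> A])
\<comment> \<open>\<open>CycL\<close> is also applicable after the replacement of the succedent,
  because the new succedent \<open>Cyc A\<close> again has the outer \<open>Cyc\<close> which that
  rule demands.\<close>
qed (blast intro: cut_free.UnderL cut_free.OverL cut_free.ProdL cut_free.CycL)+

text \<open>
  Occurrences of \<open>A\<close> are replaced simultaneously because this relation, unlike the replacement
  of a single occurrence, splits along concatenations without case distinctions.
\<close>

inductive replace :: "'p tp \<Rightarrow> 'p tp list \<Rightarrow> 'p tp list \<Rightarrow> bool" for A where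
  Nil: "replace A [] []"
| keep: "replace A \<Gamma> \<Gamma>' \<Longrightarrow> replace A (X # \<Gamma>) (X # \<Gamma>')"
| subst: "cut_free \<Pi> A \<Longrightarrow> replace A \<Gamma> \<Gamma>' \<Longrightarrow> replace A (A # \<Gamma>) (\<Pi> @ \<Gamma>')"

section \<open>Replacement along concatenations and singletons\<close>

lemma replace_refl: "replace A \<Gamma> \<Gamma>"
  by (induction \<Gamma>) (auto intro: replace.intros)

lemma replace_append: "replace A \<Gamma> \<Gamma>' \<Longrightarrow> replace A \<Delta> \<Delta>' \<Longrightarrow> replace A (\<Gamma> @ \<Delta>) (\<Gamma>' @ \<Delta>')"
  by (induction rule: replace.induct) (auto intro: replace.intros)

lemma replace_Nil_iff: "replace A [] \<Sigma> \<longleftrightarrow> \<Sigma> = []"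
  by (auto elim: replace.cases intro: replace.intros)

lemma replace_ConsE:
  assumes "replace A (X # \<Gamma>) \<Sigma>"
  obtains (keep) \<Gamma>' where "\<Sigma> = X # \<Gamma>'" "replace A \<Gamma> \<Gamma>'"
  | (subst) \<Pi> \<Gamma>' where "X = A" "\<Sigma> = \<Pi> @ \<Gamma>'" "cut_free \<Pi> A" "replace A \<Gamma> \<Gamma>'"
  using assms by (auto elim: replace.cases)

lemma replace_appendE:
  assumes "replace A (\<Gamma> @ \<Delta>) \<Sigma>"
  obtains \<Gamma>' \<Delta>' where "\<Sigma> = \<Gamma>' @ \<Delta>'" "replace A \<Gamma> \<Gamma>'" "replace A \<Delta> \<Delta>'"
proof -
  have "\<exists>\<Gamma>' \<Delta>'. \<Sigma> = \<Gamma>' @ \<Delta>' \<and> replace A \<Gamma> \<Gamma>' \<and> replace A \<Delta> \<Delta>'"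
    using assms
  proof (induction \<Gamma> arbitrary: \<Sigma>)
    case Nil
    then show ?case by (auto intro: replace.Nil)
  next
    case (Cons X \<Gamma>)
    from Cons.prems have "replace A (X # \<Gamma> @ \<Delta>) \<Sigma>" by simp
    then show ?case
    proof (cases rule: replace_ConsE)
      case (keep \<Sigma>')
      with Cons.IH show ?thesis by (metis append_Cons replace.keep)
    next
      case (subst \<Pi> \<Sigma>')
      with Cons.IH show ?thesis by (metis append_assoc replace.subst)
    qed
  qed
  with that show thesis by blast
qed

text \<open>Applied to the principal formula of a left rule, this separates the commuting case from
  the principal cut.\<close>

lemma replace_singletonE:
  assumes "replace A [X] \<Sigma>"
  obtains (keep) "\<Sigma> = [X]" | (subst) "X = A" "cut_free \<Sigma> A"
  using assms by (auto elim!: replace_ConsE simp: replace_Nil_iff)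

lemma replace_nonempty: "replace A \<Gamma> \<Gamma>' \<Longrightarrow> \<Gamma> \<noteq> [] \<Longrightarrow> \<Gamma>' \<noteq> []"
  by (induction rule: replace.induct) (auto dest: cut_free_nonempty)

text \<open>The assumption \<open>smaller\<close> is the outer induction hypothesis, for single cuts
  on smaller formulas. In the inner induction, a rule whose principal formula is not replaced is
  reapplied after replacing within each block of its antecedent.\<close>

lemma replace_admissible:
  fixes A B :: "'p tp"
  assumes smaller: "\<And>(D :: 'p tp) \<Pi> \<Gamma> \<Delta> B. size D < size A \<Longrightarrow>
      cut_free \<Pi> D \<Longrightarrow> cut_free (\<Gamma> @ [D] @ \<Delta>) B \<Longrightarrow> cut_free (\<Gamma> @ \<Pi> @ \<Delta>) B"
  shows "cut_free \<Sigma> B \<Longrightarrow> replace A \<Sigma> \<Sigma>' \<Longrightarrow> cut_free \<Sigma>' B"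
proof (induction arbitrary: \<Sigma>' rule: cut_free.induct)
  case (Ax X)
  then show ?case by (auto elim: replace_singletonE intro: cut_free.Ax)
next
  case (UnderL \<Gamma> Y \<Delta> C \<Pi> X)
  from UnderL.prems obtain \<Gamma>' \<Pi>' \<Theta> \<Delta>' where \<Sigma>': "\<Sigma>' = \<Gamma>' @ \<Pi>' @ \<Theta> @ \<Delta>'"
    and r: "replace A \<Gamma> \<Gamma>'" "replace A \<Pi> \<Pi>'" "replace A [X \<^bold>\<setminus> Y] \<Theta>" "replace A \<Delta> \<Delta>'"
    by (elim replace_appendE) blast
  \<comment> \<open>The active \<open>Y\<close> of the premise does not come from the conclusion, so
    it is kept even if it equals \<open>A\<close>.\<close>
  have C: "cut_free (\<Gamma>' @ [Y] @ \<Delta>') C"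
    using UnderL.IH(1) r replace_append replace_refl by metis
  have X: "cut_free \<Pi>' X" using UnderL.IH(2) r by blast
  from r(3) show ?case
  proof (cases rule: replace_singletonE)
    case keep
    then show ?thesis using cut_free.UnderL[OF C X] \<Sigma>' by simp
  next
    case subst
    \<comment> \<open>Principal cut: after inversion of the left premise, a cut on \<open>X\<close>
      brings in \<Pi>' and a cut on \<open>Y\<close> leads into \<open>C\<close>. Both formulas are
      proper subformulas of \<open>A\<close>.\<close>
    then have "cut_free (X # \<Theta>) Y" using Under_inversion by blast
    then have "cut_free (\<Pi>' @ \<Theta>) Y"
      using smaller[of X \<Pi>' "[]" \<Theta> Y] X subst(1)[symmetric] by simp
    then show ?thesis using smaller[OF _ _ C, of "\<Pi>' @ \<Theta>"] subst(1)[symmetric] \<Sigma>' by simp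
  qed
next
  case (UnderR \<Pi> X Y)
  then show ?case
    using replace.keep[of A \<Pi> \<Sigma>' X] by (auto intro!: cut_free.UnderR dest: replace_nonempty)
next
  case (OverL \<Gamma> Y \<Delta> C \<Pi> X)
  from OverL.prems obtain \<Gamma>' \<Pi>' \<Theta> \<Delta>' where \<Sigma>': "\<Sigma>' = \<Gamma>' @ \<Theta> @ \<Pi>' @ \<Delta>'"
    and r: "replace A \<Gamma> \<Gamma>'" "replace A \<Pi> \<Pi>'" "replace A [Y \<^bold>/ X] \<Theta>" "replace A \<Delta> \<Delta>'"
    by (elim replace_appendE) blast
  have C: "cut_free (\<Gamma>' @ [Y] @ \<Delta>') C"
    using OverL.IH(1) r replace_append replace_refl by metis
  have X: "cut_free \<Pi>' X" using OverL.IH(2) r by blast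
  from r(3) show ?case
  proof (cases rule: replace_singletonE)
    case keep
    then show ?thesis using cut_free.OverL[OF C X] \<Sigma>' by simp
  next
    case subst
    then have "cut_free (\<Theta> @ [X]) Y" using Over_inversion by blast
    then have "cut_free (\<Theta> @ \<Pi>') Y"
      using smaller[of X \<Pi>' \<Theta> "[]" Y] X subst(1)[symmetric] by simp
    then show ?thesis using smaller[OF _ _ C, of "\<Theta> @ \<Pi>'"] subst(1)[symmetric] \<Sigma>' by simp
  qed
next
  case (OverR \<Pi> X Y)
  then show ?case
    using replace_append[OF _ replace_refl, of A \<Pi> \<Sigma>' "[X]"]
    by (auto intro!: cut_free.OverR dest: replace_nonempty)
next
  case (ProdL \<Gamma> X Y \<Delta> C)
  from ProdL.prems obtain \<Gamma>' \<Theta> \<Delta>' where \<Sigma>': "\<Sigma>' = \<Gamma>' @ \<Theta> @ \<Delta>'"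
    and r: "replace A \<Gamma> \<Gamma>'" "replace A [X \<^bold>\<cdot> Y] \<Theta>" "replace A \<Delta> \<Delta>'"
    by (elim replace_appendE) blast
  have C: "cut_free (\<Gamma>' @ [X, Y] @ \<Delta>') C"
    using ProdL.IH r replace_append replace_refl by metis
  from r(2) show ?case
  proof (cases rule: replace_singletonE)
    case keep
    then show ?thesis using cut_free.ProdL[OF C] \<Sigma>' by simp
  next
    case subst
    \<comment> \<open>The factors are cut one after the other: \<open>X\<close> with
      \<open>Y\<close> still in its right context, then \<open>Y\<close> with \<Pi> already in its
      left context.\<close>
    have "cut_free (\<Gamma>' @ \<Pi> @ \<Psi> @ \<Delta>') C" if "cut_free \<Pi> X" "cut_free \<Psi> Y" for \<Pi> \<Psi>
    proof -
      have "cut_free (\<Gamma>' @ \<Pi> @ [Y] @ \<Delta>') C"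
        using smaller[of X \<Pi> \<Gamma>' "[Y] @ \<Delta>'" C] that C subst(1)[symmetric] by simp
      then show ?thesis
        using smaller[of Y \<Psi> "\<Gamma>' @ \<Pi>" \<Delta>' C] that subst(1)[symmetric] by simp
    qed
    then show ?thesis using cut_Prod[OF _ C] subst \<Sigma>' by blast
  qed
next
  case (ProdR \<Pi> X \<Psi> Y)
  then show ?case by (auto elim!: replace_appendE intro: cut_free.ProdR)
next
  case (CycR \<Pi> X)
  then show ?case by (auto intro: cut_free.CycR)
next
  case (CycL Y X)
  from CycL.prems show ?case
  proof (cases rule: replace_singletonE)
    case keep
    then show ?thesis using cut_free.CycL CycL.hyps by simp
  next
    case subst
    have "cut_free \<Pi> (Cyc X)" if "cut_free \<Pi> Y" for \<Pi>
      using smaller[of Y \<Pi> "[]" "[]" "Cyc X"] that CycL.hyps subst(1)[symmetric] by simp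
    then show ?thesis using cut_Cyc CycL.hyps subst by blast
  qed
next
  case (CycShift \<Pi> \<Psi> X)
  \<comment> \<open>Replacement acts on the two blocks independently, so swapping the results gives
    a replacement of the premise, and the shift is then redone.\<close>
  from CycShift.prems obtain \<Psi>' \<Pi>' where "\<Sigma>' = \<Psi>' @ \<Pi>'"
    and r: "replace A \<Psi> \<Psi>'" "replace A \<Pi> \<Pi>'"
    by (elim replace_appendE)
  moreover have "cut_free (\<Pi>' @ \<Psi>') (Cyc X)" using CycShift.IH r replace_append by blast
  ultimately show ?case using cut_free.CycShift replace_nonempty r CycShift.hyps by blast
qed

lemma cut_admissible:
  "cut_free \<Pi> A \<Longrightarrow> cut_free (\<Gamma> @ [A] @ \<Delta>) B \<Longrightarrow> cut_free (\<Gamma> @ \<Pi> @ \<Delta>) B"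
proof (induction A arbitrary: \<Pi> \<Gamma> \<Delta> B rule: measure_induct_rule[of size])
  case (less A)
  \<comment> \<open>A single cut is the replacement that keeps both contexts, including any
    occurrences of \<open>A\<close> in them.\<close>
  have "replace A (\<Gamma> @ [A] @ \<Delta>) (\<Gamma> @ \<Pi> @ \<Delta>)"
    using replace_append[OF replace_refl replace.subst[OF less.prems(1) replace_refl]] by simp
  with less.prems(2) show ?case by (rule replace_admissible[rotated]) (rule less.IH)
qed

section \<open>From derivation trees with cut to \<open>cut_free\<close>\<close>

lemma inference_cut_free:
  assumes "inference r Ps S" "\<forall>P \<in> set Ps. cut_free (antecedent P) (succedent P)"
  shows "cut_free (antecedent S) (succedent S)"
  using assms
proof (induction rule: inference.induct)
  case Cut
  \<comment> \<open>Disabling these simplifications keeps the form \<open>[A] @ \<Delta>\<close>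
    that \<open>cut_admissible\<close> matches.\<close>
  then show ?case by (auto intro: cut_admissible simp del: append_Cons append_Nil)
next
  case CycShift
  then show ?case by (auto intro: cut_free.CycShift)
qed (auto intro: cut_free.Ax cut_free.UnderL cut_free.UnderR cut_free.OverL cut_free.OverR
    cut_free.ProdL cut_free.ProdR cut_free.CycR cut_free.CycL
    simp del: append_Cons append_Nil append_assoc)

lemma correct_imp_cut_free:
  "correct d \<Longrightarrow> cut_free (antecedent (conclusion d)) (succedent (conclusion d))"
proof (induction d)
  case (Infer r S ds)
  have "inference r (map conclusion ds) S" using Infer.prems by simp
  moreover have "\<forall>P \<in> set (map conclusion ds). cut_free (antecedent P) (succedent P)"
    using Infer by auto
  ultimately have "cut_free (antecedent S) (succedent S)"
    by (rule inference_cut_free)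
  then show ?case by simp
qed

theorem theorem1:
  fixes S :: "'p sequent"
  assumes "derivable S"
  shows "\<exists>d. derivation_of d S \<and> Cut \<notin> rules_used d"
  using assms correct_imp_cut_free cut_free_imp_derivation
  by (metis derivable_def derivation_of_def sequent.collapse)

end
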